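(* Let $r=1$, $\lambda>0$, $L=\begin{bmatrix}0&1\\-\lambda&0\end{bmatrix}$, $\Delta t=T/N$. Denote by $\{(\bm k_n,\bm z_n)\}_n$, with $\bm k_n=[\bm k_{1,n},\bm k_{2,n}]^\top$, the sequence produced by the 2-stage Lobatto IIIC Runge–Kutta scheme applied to $\dot{\bm z}=L\bm z$ with step $\Delta t$ starting from $\bm z_0\in\mathbb{R}^2$, and by $\{\widehat{\bm z}_n\}_n$ the sequence generated by the DG1 scheme $$(I_2\otimes I_2-N^4\otimes L)\,\widehat{\bm z}_{n+1}=-(N^5\otimes I_2)\,\widehat{\bm z}_n$$ starting from $\widehat{\bm z}_0\in\mathbb{R}^4$, with $N^4,N^5$ as in the context. If $[\widehat{\bm z}_0]_{3,4}=\bm z_0$, then $$[\widehat{\bm z}_n]_{3,4}=\bm z_n\quad\text{and}\quad\widehat{\bm z}_n=(I_2\otimes L^{-1})\,\bm k_{n-1}\qquad\text{for }n=1,\dots,N.$$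
   Context: $\otimes$ is the Kronecker product; $[\bm x]_{3,4}$ is the vector of the third and fourth components of $\bm x$. Runge–Kutta scheme: $\bm k_{i,n}=L\bigl(\bm z_n+\Delta t\sum_{j}a_{ij}\bm k_{j,n}\bigr)$, $\bm z_{n+1}=\bm z_n+\Delta t\sum_ib_i\bm k_{i,n}$, the stages being stacked in $\bm k_n\in\mathbb{R}^4$. The 2-stage Lobatto IIIC method has $A=\begin{bmatrix}1/2&-1/2\\1/2&1/2\end{bmatrix}$, $\bm b=(1/2,1/2)$, $\bm c=(0,1)$. DG1 scheme: with $t_n=n\Delta t$, $I_n=(t_{n-1},t_n]$, let $\psi_{n,1}=\frac{t_n-t}{\Delta t}$, $\psi_{n,2}=\frac{t-t_{n-1}}{\Delta t}$; $N^0_{ij}=-\psi_{n,j}(t_n)\psi_{n+1,i}(t_n)$, $N^1_{ij}=\int_{I_{n+1}}\dot\psi_{n+1,j}\psi_{n+1,i}$, $N^2_{ij}=\int_{I_{n+1}}\psi_{n+1,j}\psi_{n+1,i}$, $N^3_{ij}=\psi_{n+1,j}(t_n)\psi_{n+1,i}(t_n)$, where the integrals are computed with the 2-point Gauss–Legendre–Lobatto quadrature (reference nodes $\{-1,1\}$, weights $\{1,1\}$ on $[-1,1]$); $N^4=(N^1+N^3)^{-1}N^2$, $N^5=(N^1+N^3)^{-1}N^0$ (superscripts are labels). Explicitly $N^4=\Delta t\begin{bmatrix}1/2&-1/2\\1/2&1/2\end{bmatrix}$, $N^5=\begin{bmatrix}0&-1\\0&-1\end{bmatrix}$. *)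

theory Defs
  imports "HOL-Analysis.Analysis"
begin

text \<open>
  A position in a vector of length 4 is split into a block number and a position within the
  block: 1, 2 belong to block 1 and 3, 4 to block 2. The type \<^typ>\<open>4\<close> is arithmetic modulo 4,
  so the index 4 is the same element as 0.
\<close>

definition block :: "4 \<Rightarrow> 2" where
  "block r = (if r = 1 \<or> r = 2 then 1 else 2)"

definition offset :: "4 \<Rightarrow> 2" where
  "offset r = (if r = 1 \<or> r = 3 then 1 else 2)"

definition kron :: "real^2^2 \<Rightarrow> real^2^2 \<Rightarrow> real^4^4"  (infixl "\<otimes>\<^sub>K" 70) where
  "A \<otimes>\<^sub>K B = (\<chi> r s. A $ block r $ block s * B $ offset r $ offset s)"

definition stack :: "real^2^2 \<Rightarrow> real^4" where
  "stack k = (\<chi> r. k $ block r $ offset r)"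

definition comps34 :: "real^4 \<Rightarrow> real^2" where
  "comps34 x = vector [x $ 3, x $ 4]"

text \<open>
  Runge--Kutta method for the autonomous linear system with matrix \<open>L\<close>; the stage \<open>i\<close> of step \<open>n\<close>
  is \<open>k n $ i\<close>. The abscissae of the tableau play no role because the system is autonomous.
\<close>

definition rk_scheme ::
  "real^'s^'s \<Rightarrow> real^'s \<Rightarrow> real^'m^'m \<Rightarrow> real \<Rightarrow> nat \<Rightarrow>
   (nat \<Rightarrow> real^'m^'s) \<Rightarrow> (nat \<Rightarrow> real^'m) \<Rightarrow> bool" where
  "rk_scheme A b L \<Delta>t N k z \<longleftrightarrow>
     (\<forall>n<N. (\<forall>i. k n $ i = L *v (z n + \<Delta>t *\<^sub>R (\<Sum>j\<in>UNIV. A $ i $ j *\<^sub>R (k n $ j)))) \<and>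
            z (Suc n) = z n + \<Delta>t *\<^sub>R (\<Sum>i\<in>UNIV. b $ i *\<^sub>R (k n $ i)))"

definition lobatto3C_A :: "real^2^2" where
  "lobatto3C_A = vector [vector [1/2, -1/2], vector [1/2, 1/2]]"

definition lobatto3C_b :: "real^2" where
  "lobatto3C_b = vector [1/2, 1/2]"

text \<open>
  Time steps are indexed by integers, since for \<open>n = 0\<close> the function \<open>psi \<Delta>t n\<close> belongs to the
  fictitious interval that ends at time 0.
\<close>

definition gridpt :: "real \<Rightarrow> int \<Rightarrow> real" where
  "gridpt \<Delta>t n = of_int n * \<Delta>t"

definition psi :: "real \<Rightarrow> int \<Rightarrow> 2 \<Rightarrow> real \<Rightarrow> real" where
  "psi \<Delta>t n j t = (if j = 1 then (gridpt \<Delta>t n - t) / \<Delta>t else (t - gridpt \<Delta>t (n - 1)) / \<Delta>t)"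

text \<open>
  Two-point Gauss--Legendre--Lobatto quadrature on \<open>[a, b]\<close>: the reference nodes -1 and 1, with
  weights 1, are transported from \<open>[-1, 1]\<close> by the affine map.
\<close>

definition gll2 :: "real \<Rightarrow> real \<Rightarrow> (real \<Rightarrow> real) \<Rightarrow> real" where
  "gll2 a b f = (b - a) / 2 *
     (1 * f ((a + b) / 2 + (b - a) / 2 * (-1)) + 1 * f ((a + b) / 2 + (b - a) / 2 * 1))"

definition dg_N0 :: "real \<Rightarrow> int \<Rightarrow> real^2^2" where
  "dg_N0 \<Delta>t n = (\<chi> i j. - psi \<Delta>t n j (gridpt \<Delta>t n) * psi \<Delta>t (n + 1) i (gridpt \<Delta>t n))"

definition dg_N1 :: "real \<Rightarrow> int \<Rightarrow> real^2^2" where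
  "dg_N1 \<Delta>t n = (\<chi> i j. gll2 (gridpt \<Delta>t n) (gridpt \<Delta>t (n + 1))
     (\<lambda>t. deriv (psi \<Delta>t (n + 1) j) t * psi \<Delta>t (n + 1) i t))"

definition dg_N2 :: "real \<Rightarrow> int \<Rightarrow> real^2^2" where
  "dg_N2 \<Delta>t n = (\<chi> i j. gll2 (gridpt \<Delta>t n) (gridpt \<Delta>t (n + 1))
     (\<lambda>t. psi \<Delta>t (n + 1) j t * psi \<Delta>t (n + 1) i t))"

definition dg_N3 :: "real \<Rightarrow> int \<Rightarrow> real^2^2" where
  "dg_N3 \<Delta>t n = (\<chi> i j. psi \<Delta>t (n + 1) j (gridpt \<Delta>t n) * psi \<Delta>t (n + 1) i (gridpt \<Delta>t n))"

definition dg_N4 :: "real \<Rightarrow> int \<Rightarrow> real^2^2" where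
  "dg_N4 \<Delta>t n = matrix_inv (dg_N1 \<Delta>t n + dg_N3 \<Delta>t n) ** dg_N2 \<Delta>t n"

definition dg_N5 :: "real \<Rightarrow> int \<Rightarrow> real^2^2" where
  "dg_N5 \<Delta>t n = matrix_inv (dg_N1 \<Delta>t n + dg_N3 \<Delta>t n) ** dg_N0 \<Delta>t n"

definition dg1_scheme :: "real^2^2 \<Rightarrow> real \<Rightarrow> nat \<Rightarrow> (nat \<Rightarrow> real^4) \<Rightarrow> bool" where
  "dg1_scheme L \<Delta>t N zh \<longleftrightarrow>
     (\<forall>n<N. (mat 1 \<otimes>\<^sub>K mat 1 - dg_N4 \<Delta>t (int n) \<otimes>\<^sub>K L) *v zh (Suc n)
            = (- (dg_N5 \<Delta>t (int n) \<otimes>\<^sub>K mat 1)) *v zh n)"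

lemma deriv_psi: "deriv (psi \<Delta>t n j) t = (if j = 1 then - 1 / \<Delta>t else 1 / \<Delta>t)"
proof (cases "j = 1")
  case True
  have "((\<lambda>t. (gridpt \<Delta>t n - t) / \<Delta>t) has_field_derivative - 1 / \<Delta>t) (at t)"
    by (rule DERIV_cdivide) (auto intro!: derivative_eq_intros)
  moreover have "psi \<Delta>t n j = (\<lambda>t. (gridpt \<Delta>t n - t) / \<Delta>t)"
    using True by (simp add: psi_def fun_eq_iff)
  ultimately show ?thesis using True by (simp add: DERIV_imp_deriv)
next
  case False
  have "((\<lambda>t. (t - gridpt \<Delta>t (n - 1)) / \<Delta>t) has_field_derivative 1 / \<Delta>t) (at t)"
    by (rule DERIV_cdivide) (auto intro!: derivative_eq_intros)
  moreover have "psi \<Delta>t n j = (\<lambda>t. (t - gridpt \<Delta>t (n - 1)) / \<Delta>t)"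
    using False by (simp add: psi_def fun_eq_iff)
  ultimately show ?thesis using False by (simp add: DERIV_imp_deriv)
qed

lemma psi_endpoints:
  assumes "\<Delta>t \<noteq> 0"
  shows "psi \<Delta>t n j (gridpt \<Delta>t n) = (if j = 1 then 0 else 1)"
    and "psi \<Delta>t (n + 1) j (gridpt \<Delta>t n) = (if j = 1 then 1 else 0)"
  using assms by (simp_all add: psi_def gridpt_def field_simps)

lemma gll2_grid:
  "gll2 (gridpt \<Delta>t n) (gridpt \<Delta>t (n + 1)) f =
     \<Delta>t / 2 * (f (gridpt \<Delta>t n) + f (gridpt \<Delta>t (n + 1)))"
proof -
  let ?a = "gridpt \<Delta>t n" and ?b = "gridpt \<Delta>t (n + 1)"
  have "(?a + ?b) / 2 + (?b - ?a) / 2 * (-1) = ?a" "(?a + ?b) / 2 + (?b - ?a) / 2 * 1 = ?b"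
    by (simp_all add: field_simps)
  moreover have "?b - ?a = \<Delta>t"
    by (simp add: gridpt_def algebra_simps)
  ultimately show ?thesis
    unfolding gll2_def by (simp only: mult_1)
qed

lemma dg_N_entries:
  assumes "\<Delta>t \<noteq> 0"
  shows "dg_N0 \<Delta>t n $ i $ j = (if i = 1 \<and> j = 2 then - 1 else 0)"
    and "dg_N1 \<Delta>t n $ i $ j = (if j = 1 then - 1/2 else 1/2)"
    and "dg_N2 \<Delta>t n $ i $ j = (if i = j then \<Delta>t / 2 else 0)"
    and "dg_N3 \<Delta>t n $ i $ j = (if i = 1 \<and> j = 1 then 1 else 0)"
  using assms exhaust_2[of i] exhaust_2[of j]
  by (auto simp: dg_N0_def dg_N1_def dg_N2_def dg_N3_def gll2_grid deriv_psi psi_endpoints)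

lemma matrix_inv_eqI:
  fixes E F :: "real^'n^'n"
  assumes EF: "E ** F = mat 1" and FE: "F ** E = mat 1"
  shows "matrix_inv E = F"
proof -
  have "E ** F = mat 1 \<and> F ** E = mat 1"
    using EF FE by (rule conjI)
  then have inv: "matrix_inv E ** E = mat 1"
    unfolding matrix_inv_def by (rule someI2) (erule conjunct2)
  have "matrix_inv E = matrix_inv E ** (E ** F)"
    unfolding EF by (rule matrix_mul_rid[symmetric])
  also have "\<dots> = F"
    unfolding matrix_mul_assoc inv by (rule matrix_mul_lid)
  finally show ?thesis .
qed

lemma matrix_inv_dg:
  assumes "\<Delta>t \<noteq> 0"
  shows "matrix_inv (dg_N1 \<Delta>t n + dg_N3 \<Delta>t n) = vector [vector [1, -1], vector [1, 1]]"
proof -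
  have e: "dg_N1 \<Delta>t n + dg_N3 \<Delta>t n = vector [vector [1/2, 1/2], vector [-1/2, 1/2]]"
    by (simp add: vec_eq_iff forall_2 dg_N_entries[OF assms])
  let ?E = "vector [vector [1/2, 1/2], vector [-1/2, 1/2]] :: real^2^2"
  let ?F = "vector [vector [1, -1], vector [1, 1]] :: real^2^2"
  have EF: "?E ** ?F = mat 1" and FE: "?F ** ?E = mat 1"
    by (simp_all add: vec_eq_iff forall_2 matrix_matrix_mult_def sum_2 mat_def)
  then show ?thesis
    unfolding e by (rule matrix_inv_eqI)
qed

lemma dg_N4_explicit:
  assumes "\<Delta>t \<noteq> 0"
  shows "dg_N4 \<Delta>t n = \<Delta>t *\<^sub>R vector [vector [1/2, -1/2], vector [1/2, 1/2]]"
  unfolding dg_N4_def matrix_inv_dg[OF assms]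
  by (simp add: vec_eq_iff forall_2 matrix_matrix_mult_def sum_2 dg_N_entries[OF assms])

lemma dg_N5_explicit:
  assumes "\<Delta>t \<noteq> 0"
  shows "dg_N5 \<Delta>t n = vector [vector [0, -1], vector [0, -1]]"
  unfolding dg_N5_def matrix_inv_dg[OF assms]
  by (simp add: vec_eq_iff forall_2 matrix_matrix_mult_def sum_2 dg_N_entries[OF assms])

end

theory Submission
  imports Defs
begin

text \<open>
  One step of either scheme is a linear system for two values in the plane. Let
  \<open>y\<^sub>i = z\<^sub>n + \<Delta>t \<Sum>\<^sub>j a\<^sub>i\<^sub>j k\<^sub>j\<close> be the internal Runge--Kutta stages. Since \<open>k\<^sub>i = L y\<^sub>i\<close>, they solve
  \<open>y\<^sub>i - \<Delta>t \<Sum>\<^sub>j a\<^sub>i\<^sub>j L y\<^sub>j = z\<^sub>n\<close>. This is the DG1 system: the matrix \<open>N\<^sup>4\<close> equals \<open>\<Delta>t\<close> times the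
  Lobatto IIIC tableau, and \<open>-N\<^sup>5\<close> copies the second block of the previous DG vector, its value at
  the end of the time interval, into both components of the right-hand side.

  The system has only one solution (\<open>lobatto_stages_unique\<close>): the flow of \<open>L\<close> conserves the energy
  \<open>\<lambda> x\<^sub>1\<^sup>2 + x\<^sub>2\<^sup>2\<close>, and the symmetric part of the tableau is half the identity, so the energies of
  the two stages of a homogeneous solution add up to zero. Hence, as soon as the end values
  of the previous step agree, the DG vector is the vector of the stages \<open>y\<^sub>i = L\<^sup>-\<^sup>1 k\<^sub>i\<close>.
  The agreement passes to the next step because the last row of the tableau is the weight vector,
  that is, the second stage is \<open>z\<^sub>n\<^sub>+\<^sub>1\<close> itself.
\<close>

definition unstack :: "real^4 \<Rightarrow> real^2^2" where
  "unstack x = vector [vector [x $ 1, x $ 2], vector [x $ 3, x $ 4]]"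

lemma stack_unstack: "stack (unstack x) = x"
  by (simp add: vec_eq_iff forall_4 stack_def unstack_def block_def offset_def)

lemma stack_inject: "stack x = stack y \<longleftrightarrow> x = y"
  by (auto simp: vec_eq_iff forall_4 forall_2 stack_def block_def offset_def)

lemma stack_diff: "stack x - stack y = stack (x - y)"
  by (simp add: vec_eq_iff stack_def)

lemma comps34_stack: "comps34 (stack x) = x $ 2"
  by (simp add: vec_eq_iff forall_2 comps34_def stack_def block_def offset_def)

text \<open>
  The Kronecker product mixes the blocks by its first factor and acts inside each block by its
  second factor, so a system of length 4 becomes two coupled equations in the plane.
\<close>

lemma kron_stack:
  "(A \<otimes>\<^sub>K B) *v stack x = stack (\<chi> i. \<Sum>j\<in>UNIV. A $ i $ j *\<^sub>R (B *v x $ j))"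
  by (simp add: vec_eq_iff forall_4 stack_def kron_def matrix_vector_mult_def block_def offset_def
      sum_4 sum_2 algebra_simps)

lemma kron_mat1_stack: "(mat 1 \<otimes>\<^sub>K B) *v stack x = stack (\<chi> i. B *v x $ i)"
  unfolding kron_stack stack_inject by (simp add: vec_eq_iff forall_2 sum_2 mat_def)

text \<open>
  With \<open>h = \<Delta>t / 2\<close> and \<open>f = L\<close> these are the homogeneous stage equations. By skewness, \<open>u - v\<close> is
  \<open>q\<close>-orthogonal to \<open>f (u - v)\<close>, hence to \<open>u\<close>, and likewise \<open>u + v\<close> to \<open>v\<close>. In the sum of these two
  relations the mixed terms cancel and leave \<open>q u u + q v v = 0\<close>.
\<close>

lemma lobatto_homogeneous_zero:
  fixes f :: "'a::real_vector \<Rightarrow> 'a" and q :: "'a \<Rightarrow> 'a \<Rightarrow> real"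
  assumes q: "bilinear q" and sym: "\<And>x y. q x y = q y x"
    and pos: "\<And>x. x \<noteq> 0 \<Longrightarrow> q x x > 0" and skew: "\<And>x. q x (f x) = 0"
    and u: "u = h *\<^sub>R f (u - v)" and v: "v = h *\<^sub>R f (u + v)"
  shows "u = 0 \<and> v = 0"
proof -
  have "q (u - v) u = 0"
    by (subst (2) u) (simp add: bilinear_rmul[OF q] skew)
  moreover have "q (u + v) v = 0"
    by (subst (2) v) (simp add: bilinear_rmul[OF q] skew)
  ultimately have "q u u + q v v = 0"
    using sym[of u v] by (simp add: bilinear_lsub[OF q] bilinear_ladd[OF q])
  moreover have "q x x \<ge> 0" for x
    using pos[of x] bilinear_lzero[OF q] by (cases "x = 0") auto
  ultimately have "q u u = 0" and "q v v = 0"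
    by (simp_all add: add_nonneg_eq_0_iff)
  then show ?thesis
    using pos by fastforce
qed

definition energy_form :: "real \<Rightarrow> real^2 \<Rightarrow> real^2 \<Rightarrow> real" where
  "energy_form lam x y = lam * x $ 1 * y $ 1 + x $ 2 * y $ 2"

lemma bilinear_energy_form: "bilinear (energy_form lam)"
  unfolding bilinear_def energy_form_def
  by (auto intro!: linearI simp: algebra_simps)

lemma energy_form_sym: "energy_form lam x y = energy_form lam y x"
  by (simp add: energy_form_def mult_ac)

lemma energy_form_pos:
  assumes "lam > 0" and "x \<noteq> 0"
  shows "energy_form lam x x > 0"
proof -
  have "x $ 1 \<noteq> 0 \<or> x $ 2 \<noteq> 0"
    using assms(2) by (auto simp: vec_eq_iff forall_2)
  moreover have "0 < lam * (x $ 1)\<^sup>2" if "x $ 1 \<noteq> 0"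
    using that assms(1) by simp
  moreover have "0 \<le> lam * (x $ 1)\<^sup>2"
    using assms(1) by simp
  moreover have "0 < (x $ 2)\<^sup>2" if "x $ 2 \<noteq> 0"
    using that by simp
  moreover have "0 \<le> (x $ 2)\<^sup>2"
    by simp
  ultimately have "0 < lam * (x $ 1)\<^sup>2 + (x $ 2)\<^sup>2"
    by linarith
  then show ?thesis
    by (simp add: energy_form_def power2_eq_square mult.assoc)
qed

definition oscillator :: "real \<Rightarrow> real^2^2" where
  "oscillator lam = vector [vector [0, 1], vector [-lam, 0]]"

lemma energy_form_oscillator: "energy_form lam x (oscillator lam *v x) = 0"
  by (simp add: energy_form_def oscillator_def matrix_vector_mult_def sum_2)

lemma oscillator_inverse:
  assumes "lam \<noteq> 0"
  shows "matrix_inv (oscillator lam) *v (oscillator lam *v x) = x"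
proof -
  let ?F = "vector [vector [0, -1 / lam], vector [1, 0]] :: real^2^2"
  have *: "oscillator lam ** ?F = mat 1" "?F ** oscillator lam = mat 1"
    using assms by (simp_all add: oscillator_def vec_eq_iff forall_2 matrix_matrix_mult_def sum_2
        mat_def)
  show ?thesis
    unfolding matrix_inv_eqI[OF *] matrix_vector_mul_assoc *(2) by simp
qed

definition stage_eqs :: "real^2^2 \<Rightarrow> real \<Rightarrow> real^2 \<Rightarrow> real^2^2 \<Rightarrow> bool" where
  "stage_eqs L \<Delta>t z y \<longleftrightarrow>
     (\<forall>i. y $ i = z + \<Delta>t *\<^sub>R (\<Sum>j\<in>UNIV. lobatto3C_A $ i $ j *\<^sub>R (L *v y $ j)))"

lemma lobatto_stages_unique:
  assumes lam: "lam > 0"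
    and x: "stage_eqs (oscillator lam) \<Delta>t z x" and y: "stage_eqs (oscillator lam) \<Delta>t z y"
  shows "x = y"
proof -
  let ?L = "oscillator lam"
  let ?u = "x $ 1 - y $ 1" and ?v = "x $ 2 - y $ 2"
  note stages = x[unfolded stage_eqs_def forall_2] y[unfolded stage_eqs_def forall_2]
  have u: "?u = (\<Delta>t / 2) *\<^sub>R (?L *v (?u - ?v))"
    using stages
    by (simp add: vec_eq_iff forall_2 lobatto3C_A_def sum_2 matrix_vector_mult_def algebra_simps)
  have v: "?v = (\<Delta>t / 2) *\<^sub>R (?L *v (?u + ?v))"
    using stages
    by (simp add: vec_eq_iff forall_2 lobatto3C_A_def sum_2 matrix_vector_mult_def algebra_simps)
  have "?u = 0 \<and> ?v = 0"
    by (rule lobatto_homogeneous_zero[where f = "(*v) ?L" and q = "energy_form lam",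
          OF bilinear_energy_form energy_form_sym _ energy_form_oscillator u v])
      (rule energy_form_pos[OF lam])
  then show ?thesis
    by (simp add: vec_eq_iff[of x y] forall_2)
qed

text \<open>
  The stages themselves are recovered from the slopes by inverting \<open>L\<close>. The end value is the second
  stage because the second row of the tableau coincides with the weights.
\<close>

lemma rk_step_stage_eqs:
  assumes "rk_scheme lobatto3C_A lobatto3C_b L \<Delta>t N k z" and "n < N"
    and inv: "\<And>x. M *v (L *v x) = x"
  shows "stage_eqs L \<Delta>t (z n) (\<chi> i. M *v k n $ i)" and "z (Suc n) = M *v k n $ 2"
proof -
  define y where "y i = z n + \<Delta>t *\<^sub>R (\<Sum>j\<in>UNIV. lobatto3C_A $ i $ j *\<^sub>R (k n $ j))" for i
  have k: "k n $ i = L *v y i" for i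
    using assms(1,2) unfolding rk_scheme_def y_def by blast
  have y: "M *v k n $ i = y i" for i
    unfolding k inv ..
  show "stage_eqs L \<Delta>t (z n) (\<chi> i. M *v k n $ i)"
    unfolding stage_eqs_def by (simp add: y k[symmetric]) (simp add: y_def)
  have "lobatto3C_A $ 2 = lobatto3C_b"
    by (simp add: lobatto3C_A_def lobatto3C_b_def)
  moreover have "z (Suc n) = z n + \<Delta>t *\<^sub>R (\<Sum>i\<in>UNIV. lobatto3C_b $ i *\<^sub>R (k n $ i))"
    using assms(1,2) unfolding rk_scheme_def by blast
  ultimately show "z (Suc n) = M *v k n $ 2"
    unfolding y y_def by simp
qed

text \<open>
  The second column of \<open>-N\<^sup>5\<close> consists of ones and the first one vanishes, so the right-hand side
  of the DG step contains the old end value twice: it becomes the initial value of both stages.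
\<close>

lemma dg_step_stage_eqs:
  assumes "dg1_scheme L \<Delta>t N zh" and "n < N" and dt: "\<Delta>t \<noteq> 0"
  shows "stage_eqs L \<Delta>t (comps34 (zh n)) (unstack (zh (Suc n)))"
proof -
  let ?x = "unstack (zh n)" and ?y = "unstack (zh (Suc n))"
  have N4: "dg_N4 \<Delta>t (int n) = \<Delta>t *\<^sub>R lobatto3C_A"
    unfolding dg_N4_explicit[OF dt] lobatto3C_A_def ..
  have "(mat 1 \<otimes>\<^sub>K mat 1 - dg_N4 \<Delta>t (int n) \<otimes>\<^sub>K L) *v stack ?y
      = (- (dg_N5 \<Delta>t (int n) \<otimes>\<^sub>K mat 1)) *v stack ?x"
    using assms(1,2) unfolding dg1_scheme_def stack_unstack by blast
  moreover have "(- (dg_N5 \<Delta>t (int n) \<otimes>\<^sub>K mat 1)) *v stack ?x = stack (\<chi> i. ?x $ 2)"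
  proof -
    have neg: "- (A \<otimes>\<^sub>K B) = (- A) \<otimes>\<^sub>K B" for A B
      by (simp add: kron_def vec_eq_iff)
    show ?thesis
      unfolding neg kron_stack stack_inject dg_N5_explicit[OF dt]
      by (simp add: vec_eq_iff forall_2 sum_2)
  qed
  ultimately have "(\<chi> i. ?y $ i)
      - (\<chi> i. \<Sum>j\<in>UNIV. (\<Delta>t *\<^sub>R lobatto3C_A) $ i $ j *\<^sub>R (L *v ?y $ j)) = (\<chi> i. ?x $ 2)"
    unfolding matrix_vector_mult_diff_rdistrib kron_mat1_stack N4
      kron_stack[of "\<Delta>t *\<^sub>R lobatto3C_A"] stack_diff by (simp add: stack_inject)
  moreover have "?x $ 2 = comps34 (zh n)"
    using comps34_stack[of ?x] by (simp add: stack_unstack)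
  ultimately show ?thesis
    unfolding stage_eqs_def by (simp add: vec_eq_iff scaleR_sum_right algebra_simps)
qed

theorem corollary9:
  fixes lam T :: real and N :: nat
    and L :: "real^2^2" and \<Delta>t :: real
    and k :: "nat \<Rightarrow> real^2^2" and z :: "nat \<Rightarrow> real^2" and zh :: "nat \<Rightarrow> real^4"
  assumes "lam > 0" and "T > 0" and "N \<ge> 1"
    and "L = vector [vector [0, 1], vector [-lam, 0]]"
    and "\<Delta>t = T / real N"
    and "rk_scheme lobatto3C_A lobatto3C_b L \<Delta>t N k z"
    and "dg1_scheme L \<Delta>t N zh"
    and "comps34 (zh 0) = z 0"
  shows "\<forall>n\<in>{1..N}. comps34 (zh n) = z n \<and>
           zh n = (mat 1 \<otimes>\<^sub>K matrix_inv L) *v stack (k (n - 1))"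
proof -
  have L: "L = oscillator lam"
    using assms(4) by (simp add: oscillator_def)
  have dt: "\<Delta>t \<noteq> 0"
    using assms(2,3,5) by simp
  have inv: "matrix_inv L *v (L *v x) = x" for x
    unfolding L using assms(1) by (intro oscillator_inverse) simp
  have step: "zh (Suc n) = (mat 1 \<otimes>\<^sub>K matrix_inv L) *v stack (k n) \<and> comps34 (zh (Suc n)) = z (Suc n)"
    if "n < N" and "comps34 (zh n) = z n" for n
  proof -
    note rk = rk_step_stage_eqs[OF assms(6) that(1) inv]
    have "unstack (zh (Suc n)) = (\<chi> i. matrix_inv L *v k n $ i)"
      using lobatto_stages_unique[OF assms(1)] rk(1)
        dg_step_stage_eqs[OF assms(7) that(1) dt] that(2) unfolding L by metis
    then have zh: "zh (Suc n) = stack (\<chi> i. matrix_inv L *v k n $ i)"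
      by (metis stack_unstack)
    show ?thesis
      unfolding zh kron_mat1_stack comps34_stack rk(2) by simp
  qed
  have agree: "comps34 (zh n) = z n" if "n \<le> N" for n
    using that
  proof (induction n)
    case 0
    show ?case by (rule assms(8))
  next
    case (Suc n)
    then have "n < N" and "comps34 (zh n) = z n" by simp_all
    then show ?case using step by blast
  qed
  show ?thesis
  proof
    fix n
    assume n: "n \<in> {1..N}"
    then show "comps34 (zh n) = z n \<and> zh n = (mat 1 \<otimes>\<^sub>K matrix_inv L) *v stack (k (n - 1))"
      using step[of "n - 1"] agree[of "n - 1"] agree[of n] by auto
  qed
qed

end
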